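(* Let $\mathbb{K}$ be a field of characteristic zero. For every rational number $\frac{a}{b} \geq 1$ there exists a square-free principal Borel ideal $I$ (in a polynomial ring $\mathbb{K}[x_1,\ldots,x_n]$ for some $n$) such that $\widehat{\alpha}(I) = \frac{a}{b}$.
   Context: Let $S=\mathbb{K}[x_1,\ldots,x_n]$. Borel moves: for a monomial $m$, if $x_i \mid m$ and $j<i$, then $x_j\cdot\frac{m}{x_i}$ is called a Borel move of $m$. For a square-free monomial $m\in S$, ${\rm sfBorel}(m)\subseteq S$ is the square-free monomial ideal generated by all square-free monomials that can be obtained from $m$ by a (possibly empty) sequence of Borel moves. An ideal of the form ${\rm sfBorel}(m)$ is called a square-free principal Borel ideal. Waldschmidt constant: for a square-free monomial ideal $I$ with minimal primary decomposition $I=P_1\cap\cdots\cap P_t$, the $q$-th symbolic power is $I^{(q)}=P_1^q\cap\cdots\cap P_t^q$. For a homogeneous ideal $J$, $\alpha(J)$ denotes the smallest degree of a generator of $J$. The Waldschmidt constant of $I$ is $\widehat{\alpha}(I)=\lim_{q\to\infty}\alpha(I^{(q)})/q$. *)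

theory Defs
  imports
    Complex_Main
    "HOL-Library.Poly_Mapping"
    "HOL-Algebra.Ideal_Product"
begin

section \<open>The polynomial ring in n variables\<close>

text \<open>
  A monomial is its exponent vector, a polynomial is a finitely supported family of coefficients.
  The ambient type has variables indexed by all of \<^typ>\<open>nat\<close>; the carrier of \<open>poly_ring n\<close> cuts this
  down to the polynomials in the variables with indices \<open>1, \<dots>, n\<close>, so that ideals are
  ideals of the polynomial ring in exactly \<open>n\<close> variables.
\<close>

type_synonym monomial = "nat \<Rightarrow>\<^sub>0 nat"

type_synonym 'k mpoly = "monomial \<Rightarrow>\<^sub>0 'k"

definition monomials :: "nat \<Rightarrow> monomial set" where
  "monomials n = {m. Poly_Mapping.keys m \<subseteq> {1..n}}"

definition poly_ring :: "nat \<Rightarrow> 'k::field mpoly ring" where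
  "poly_ring n =
     \<lparr>carrier = {p. Poly_Mapping.keys p \<subseteq> monomials n}, mult = (*), one = 1, zero = 0, add = (+)\<rparr>"

definition monomial_degree :: "monomial \<Rightarrow> nat" where
  "monomial_degree m = (\<Sum>i\<in>Poly_Mapping.keys m. Poly_Mapping.lookup m i)"

definition squarefree_monomial :: "monomial \<Rightarrow> bool" where
  "squarefree_monomial m \<longleftrightarrow> (\<forall>i. Poly_Mapping.lookup m i \<le> 1)"

text \<open>The zero polynomial is excluded, so that the degree \<open>d\<close> is determined by \<open>p\<close>.\<close>

definition homogeneous_of_degree :: "nat \<Rightarrow> 'k::field mpoly \<Rightarrow> bool" where
  "homogeneous_of_degree d p \<longleftrightarrow> p \<noteq> 0 \<and> (\<forall>m\<in>Poly_Mapping.keys p. monomial_degree m = d)"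


section \<open>Square-free principal Borel ideals\<close>

text \<open>
  The variables start at index \<open>1\<close>. Since \<open>i\<close> is a key of \<open>m\<close>, the pointwise truncated difference
  \<open>m - single i 1\<close> is the exponent vector of \<open>m / x\<^sub>i\<close>.
\<close>

definition borel_move :: "monomial \<Rightarrow> monomial \<Rightarrow> bool" where
  "borel_move m m' \<longleftrightarrow>
     (\<exists>i\<in>Poly_Mapping.keys m. \<exists>j\<in>{1..<i}.
        m' = Poly_Mapping.single j 1 + (m - Poly_Mapping.single i 1))"

text \<open>Only the final monomial of a sequence of moves has to be square-free.\<close>

definition sfBorel :: "nat \<Rightarrow> monomial \<Rightarrow> 'k::field mpoly set" where
  "sfBorel n m =
     Idl\<^bsub>poly_ring n\<^esub>
       {Poly_Mapping.single m' 1 | m'. borel_move\<^sup>*\<^sup>* m m' \<and> squarefree_monomial m'}"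

definition sf_principal_borel_ideal :: "nat \<Rightarrow> 'k::field mpoly set \<Rightarrow> bool" where
  "sf_principal_borel_ideal n I \<longleftrightarrow>
     (\<exists>m\<in>monomials n. squarefree_monomial m \<and> I = sfBorel n m)"


section \<open>Minimal primary decompositions and symbolic powers\<close>

definition radical_ideal :: "('a, 'b) ring_scheme \<Rightarrow> 'a set \<Rightarrow> 'a set" where
  "radical_ideal R I = {a \<in> carrier R. \<exists>k::nat. a [^]\<^bsub>R\<^esub> k \<in> I}"

definition primary_ideal :: "('a, 'b) ring_scheme \<Rightarrow> 'a set \<Rightarrow> bool" where
  "primary_ideal R Q \<longleftrightarrow>
     ideal Q R \<and> Q \<noteq> carrier R \<and>
     (\<forall>a\<in>carrier R. \<forall>b\<in>carrier R. a \<otimes>\<^bsub>R\<^esub> b \<in> Q \<longrightarrow> a \<in> Q \<or> b \<in> radical_ideal R Q)"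

text \<open>
  Intersections of families of ideals are taken inside \<open>carrier R\<close>, so that the empty intersection
  is the unit ideal.
\<close>

definition minimal_primary_decomposition ::
    "('a, 'b) ring_scheme \<Rightarrow> 'a set \<Rightarrow> 'a set set \<Rightarrow> bool" where
  "minimal_primary_decomposition R I \<P> \<longleftrightarrow>
     finite \<P> \<and> (\<forall>P\<in>\<P>. primary_ideal R P) \<and> I = carrier R \<inter> \<Inter>\<P> \<and>
     inj_on (radical_ideal R) \<P> \<and>
     (\<forall>P\<in>\<P>. carrier R \<inter> \<Inter>(\<P> - {P}) \<noteq> I)"

text \<open>
  Only meant for ideals with a unique minimal primary decomposition. Square-free monomial ideals
  have one, consisting of their minimal primes; see \<open>minimal_primary_decomposition_unique\<close> below.
  Powers of ideals are powers in the library's monoid of ideals, with the zeroth power being the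
  unit ideal.
\<close>

definition symbolic_power :: "('a, 'b) ring_scheme \<Rightarrow> 'a set \<Rightarrow> nat \<Rightarrow> 'a set" where
  "symbolic_power R I q =
     carrier R \<inter>
       (\<Inter>P\<in>(THE \<P>. minimal_primary_decomposition R I \<P>). P [^]\<^bsub>ideals_set R\<^esub> q)"


section \<open>The Waldschmidt constant\<close>

text \<open>
  The smallest degree of a generator does not depend on the chosen system \<open>G\<close> of nonzero
  homogeneous generators, so it does no harm to minimise over all systems simultaneously.
  The value for the zero ideal is not meaningful.
\<close>

definition alpha :: "nat \<Rightarrow> 'k::field mpoly set \<Rightarrow> nat" where
  "alpha n J =
     (LEAST d. \<exists>G. G \<subseteq> carrier (poly_ring n) \<and> (\<forall>g\<in>G. \<exists>e. homogeneous_of_degree e g) \<and>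
                   J = Idl\<^bsub>poly_ring n\<^esub> G \<and> (\<exists>g\<in>G. homogeneous_of_degree d g))"

text \<open>
  Relational, so that the existence of the limit is part of the assertion; \<open>c\<close> is unique by
  uniqueness of limits. The term for \<open>q = 0\<close> is irrelevant.
\<close>

definition has_waldschmidt_constant :: "nat \<Rightarrow> 'k::field mpoly set \<Rightarrow> real \<Rightarrow> bool" where
  "has_waldschmidt_constant n I c \<longleftrightarrow>
     (\<lambda>q. real (alpha n (symbolic_power (poly_ring n) I q)) / real q) \<longlonglongrightarrow> c"


section \<open>Well-definedness\<close>

lemma monomials_add: "a \<in> monomials n \<Longrightarrow> b \<in> monomials n \<Longrightarrow> a + b \<in> monomials n"
  unfolding monomials_def using keys_add[of a b] by auto

lemma cring_poly_ring: "cring (poly_ring n :: 'k::field mpoly ring)"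
proof (rule cringI)
  show "abelian_group (poly_ring n :: 'k mpoly ring)"
  proof (rule abelian_groupI)
    fix x y :: "'k mpoly"
    assume "x \<in> carrier (poly_ring n)" "y \<in> carrier (poly_ring n)"
    then show "x \<oplus>\<^bsub>poly_ring n\<^esub> y \<in> carrier (poly_ring n)"
      using keys_add[of x y] by (auto simp: poly_ring_def)
  next
    fix x :: "'k mpoly"
    assume "x \<in> carrier (poly_ring n)"
    then have "- x \<in> carrier (poly_ring n)" "- x + x = 0"
      by (auto simp: poly_ring_def)
    then show "\<exists>y\<in>carrier (poly_ring n). y \<oplus>\<^bsub>poly_ring n\<^esub> x = \<zero>\<^bsub>poly_ring n\<^esub>"
      unfolding poly_ring_def by (intro bexI[of _ "- x"]) auto
  qed (auto simp: poly_ring_def add_ac)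
  show "comm_monoid (poly_ring n :: 'k mpoly ring)"
  proof (rule comm_monoidI)
    fix x y :: "'k mpoly"
    assume "x \<in> carrier (poly_ring n)" "y \<in> carrier (poly_ring n)"
    then show "x \<otimes>\<^bsub>poly_ring n\<^esub> y \<in> carrier (poly_ring n)"
      using keys_mult[of x y] monomials_add[of _ n] by (fastforce simp: poly_ring_def)
  next
    show "\<one>\<^bsub>poly_ring n\<^esub> \<in> carrier (poly_ring n :: 'k mpoly ring)"
      by (auto simp: poly_ring_def monomials_def)
  qed (auto simp: poly_ring_def mult_ac)
qed (auto simp: poly_ring_def algebra_simps)

lemma (in cring) Inter_subset_primeideal:
  assumes P: "primeideal P R"
  shows "finite \<F> \<Longrightarrow> (\<And>Q. Q \<in> \<F> \<Longrightarrow> ideal Q R) \<Longrightarrow> carrier R \<inter> \<Inter>\<F> \<subseteq> P \<Longrightarrow> \<exists>Q\<in>\<F>. Q \<subseteq> P"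
proof (induction \<F> rule: finite_induct)
  case empty
  interpret primeideal P R by (rule P)
  show ?case using empty I_notcarr a_subset by auto
next
  case (insert Q \<F>)
  interpret P: primeideal P R by (rule P)
  interpret Q: ideal Q R using insert.prems(1) by simp
  show ?case
  proof (rule ccontr)
    assume none: "\<not> ?thesis"
    then have "\<not> carrier R \<inter> \<Inter>\<F> \<subseteq> P"
      using insert.IH insert.prems(1) by auto
    then obtain y where y: "y \<in> carrier R" "\<And>Q'. Q' \<in> \<F> \<Longrightarrow> y \<in> Q'" "y \<notin> P" by auto
    from none obtain x where x: "x \<in> Q" "x \<notin> P" by auto
    then have xc: "x \<in> carrier R" using Q.Icarr by simp
    have "x \<otimes> y \<in> Q" using x y Q.I_r_closed by simp
    moreover have "x \<otimes> y \<in> Q'" if "Q' \<in> \<F>" for Q'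
      using ideal.I_l_closed[of Q' R y x] insert.prems(1)[of Q'] that y xc by auto
    ultimately have "x \<otimes> y \<in> P" using insert.prems(2) xc y by auto
    then show False using P.I_prime xc x y by blast
  qed
qed

lemma (in cring) primeideal_pow:
  assumes "primeideal P R" "a \<in> carrier R" "a [^] (k::nat) \<in> P"
  shows "a \<in> P"
proof -
  interpret primeideal P R by fact
  show ?thesis using assms(3)
  proof (induction k)
    case 0
    then show ?case using one_imp_carrier I_notcarr by auto
  next
    case (Suc k)
    then show ?case using I_prime[of "a [^] k" a] assms(2) by auto
  qed
qed

lemma (in cring) radical_ideal_superset: "ideal Q R \<Longrightarrow> Q \<subseteq> radical_ideal R Q"
  unfolding radical_ideal_def
  using ideal.Icarr[of Q R] by (auto intro!: exI[of _ "Suc 0"])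

lemma (in cring) radical_primeideal: "primeideal P R \<Longrightarrow> radical_ideal R P = P"
  using primeideal_pow radical_ideal_superset[of P] primeideal.axioms(1)
  unfolding radical_ideal_def by blast

text \<open>
  A decomposition into finitely many pairwise incomparable primes, such as the one into the minimal
  primes of a square-free monomial ideal, is the only minimal primary decomposition.
\<close>

lemma (in cring) minimal_primary_decomposition_unique:
  assumes fin: "finite \<P>"
    and prime: "\<And>P. P \<in> \<P> \<Longrightarrow> primeideal P R"
    and incomp: "\<And>P P'. P \<in> \<P> \<Longrightarrow> P' \<in> \<P> \<Longrightarrow> P \<subseteq> P' \<Longrightarrow> P = P'"
    and I: "I = carrier R \<inter> \<Inter>\<P>"
  shows "(THE \<Q>. minimal_primary_decomposition R I \<Q>) = \<P>"
proof (rule the_equality)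
  have idl: "ideal P R" if "P \<in> \<P>" for P
    using prime[OF that] primeideal.axioms(1) by blast
  have avoid: "\<not> carrier R \<inter> \<Inter>(\<P> - {P}) \<subseteq> P" if P: "P \<in> \<P>" for P
  proof
    assume "carrier R \<inter> \<Inter>(\<P> - {P}) \<subseteq> P"
    then obtain P' where "P' \<in> \<P> - {P}" "P' \<subseteq> P"
      using Inter_subset_primeideal[OF prime[OF P], of "\<P> - {P}"] fin idl by auto
    with incomp[of P' P] P show False by auto
  qed
  show "minimal_primary_decomposition R I \<P>"
    unfolding minimal_primary_decomposition_def
  proof (intro conjI ballI)
    fix P assume P: "P \<in> \<P>"
    show "primary_ideal R P"
      unfolding primary_ideal_def radical_primeideal[OF prime[OF P]]
      using idl[OF P] primeideal.I_notcarr[OF prime[OF P]] primeideal.I_prime[OF prime[OF P]] by auto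
    show "carrier R \<inter> \<Inter>(\<P> - {P}) \<noteq> I" using avoid[OF P] P I by auto
  next
    show "inj_on (radical_ideal R) \<P>" by (rule inj_onI) (simp add: radical_primeideal prime)
  qed (use fin I in auto)

  fix \<Q> assume \<Q>: "minimal_primary_decomposition R I \<Q>"
  then have finQ: "finite \<Q>" and prim: "\<And>Q. Q \<in> \<Q> \<Longrightarrow> primary_ideal R Q"
    and IQ: "I = carrier R \<inter> \<Inter>\<Q>"
    and irr: "\<And>Q. Q \<in> \<Q> \<Longrightarrow> carrier R \<inter> \<Inter>(\<Q> - {Q}) \<noteq> I"
    unfolding minimal_primary_decomposition_def by auto
  have idlQ: "ideal Q R" if "Q \<in> \<Q>" for Q
    using prim[OF that] unfolding primary_ideal_def by blast
  have sub: "\<P> \<subseteq> \<Q>"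
  proof
    fix P assume P: "P \<in> \<P>"
    have "carrier R \<inter> \<Inter>\<Q> \<subseteq> P" using IQ I P by auto
    then obtain Q where Q: "Q \<in> \<Q>" "Q \<subseteq> P"
      using Inter_subset_primeideal[OF prime[OF P] finQ idlQ] by auto
    from avoid[OF P] obtain y where y: "y \<in> carrier R" "y \<in> \<Inter>(\<P> - {P})" "y \<notin> P" by auto
    have y_rad: "y \<notin> radical_ideal R Q"
      using primeideal_pow[OF prime[OF P] y(1)] Q(2) y(3) unfolding radical_ideal_def by blast
    have "P \<subseteq> Q"
    proof
      fix x assume x: "x \<in> P"
      then have xc: "x \<in> carrier R" using ideal.Icarr[OF idl[OF P]] by simp
      have "x \<otimes> y \<in> P'" if "P' \<in> \<P>" for P'
      proof (cases "P' = P")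
        case True
        then show ?thesis using ideal.I_r_closed[OF idl[OF P] x y(1)] by simp
      next
        case False
        then have "y \<in> P'" using y(2) that by auto
        then show ?thesis using ideal.I_l_closed[OF idl[OF that] _ xc] by simp
      qed
      then have "x \<otimes> y \<in> I" using I xc y(1) by auto
      then have "x \<otimes> y \<in> Q" using IQ Q(1) by auto
      then show "x \<in> Q" using prim[OF Q(1)] y_rad xc y(1) unfolding primary_ideal_def by blast
    qed
    with Q show "P \<in> \<Q>" by auto
  qed
  show "\<Q> = \<P>"
  proof (rule ccontr)
    assume "\<Q> \<noteq> \<P>"
    with sub obtain Q where Q: "Q \<in> \<Q>" "Q \<notin> \<P>" by auto
    then have "carrier R \<inter> \<Inter>(\<Q> - {Q}) = I" using sub I IQ by auto
    with irr[OF Q(1)] show False by simp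
  qed
qed

end

theory Submission
  imports Defs
begin

text \<open>
  Write \<open>r = n / b\<close> with integers \<open>n \<ge> b \<ge> 1\<close>. The ideal that works is the square-free Veronese
  ideal \<open>sfBorel(x\<^sub>b x\<^sub>b\<^sub>+\<^sub>1 \<dots> x\<^sub>n)\<close>. The monomial \<open>x\<^sub>b \<dots> x\<^sub>n\<close> uses the last \<open>n - b + 1\<close> variables,
  so Borel moves lead from it to every square-free monomial of that degree
  (\<open>borel_moves_from_top\<close>). A subset of \<open>{1..n}\<close> contains a subset of size \<open>n - b + 1\<close> exactly
  when it meets every subset of size \<open>b\<close>; hence the ideal is the intersection of the primes
  \<open>P\<^sub>C = (x\<^sub>i : i \<in> C)\<close> over all \<open>C\<close> with \<open>b\<close> elements (\<open>sfBorel_veronese\<close>). These primes are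
  pairwise incomparable, so they form its minimal primary decomposition, and the \<open>q\<close>-th symbolic
  power is spanned by the monomials whose exponents sum to at least \<open>q\<close> over every such \<open>C\<close>
  (\<open>symbolic_power_veronese\<close>).

  It remains to find the least degree \<open>\<alpha>\<close> of such a monomial. Averaging the conditions over all
  \<open>C\<close> gives \<open>b \<alpha> \<ge> n q\<close> (\<open>sum_lower_bound_from_subsets\<close>), while giving every variable an exponent
  just above \<open>q / b\<close> shows \<open>b \<alpha> \<le> n (q + b)\<close>. Dividing by \<open>b q\<close> and letting \<open>q\<close> tend to infinity
  leaves \<open>n / b\<close>.

  All ideals involved are spanned by monomials, and such an ideal is treated as the set of
  polynomials whose monomials lie in a given set. This reduces products, intersections and \<open>alpha\<close>
  to statements on exponent vectors.
\<close>

section \<open>Ideals spanned by monomials\<close>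

definition monomial_ideal :: "nat \<Rightarrow> monomial set \<Rightarrow> 'k::field mpoly set" where
  "monomial_ideal n M = {p. Poly_Mapping.keys p \<subseteq> monomials n \<inter> M}"

text \<open>
  The condition on \<open>M\<close> under which \<open>monomial_ideal n M\<close> is an ideal: the monomials of \<open>M\<close> in
  \<open>n\<close> variables are closed under taking multiples.
\<close>

definition absorbing :: "nat \<Rightarrow> monomial set \<Rightarrow> bool" where
  "absorbing n M \<longleftrightarrow> (\<forall>m\<in>monomials n \<inter> M. \<forall>u\<in>monomials n. u + m \<in> M)"

lemma poly_ring_simps [simp]:
  "x \<otimes>\<^bsub>poly_ring n\<^esub> y = x * y" "x \<oplus>\<^bsub>poly_ring n\<^esub> y = x + y"
  "\<one>\<^bsub>poly_ring n\<^esub> = 1" "\<zero>\<^bsub>poly_ring n\<^esub> = 0"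
  by (simp_all add: poly_ring_def)

lemma carrier_poly_ring: "carrier (poly_ring n) = monomial_ideal n UNIV"
  by (auto simp: poly_ring_def monomial_ideal_def)

lemma ring_poly_ring: "ring (poly_ring n :: 'k::field mpoly ring)"
  by (rule cring.axioms(1)[OF cring_poly_ring])

lemma single_in_monomial_ideal:
  "m \<in> monomials n \<Longrightarrow> m \<in> M \<Longrightarrow> Poly_Mapping.single m c \<in> monomial_ideal n M"
  by (simp add: monomial_ideal_def)

lemma add_in_monomial_ideal:
  "p \<in> monomial_ideal n M \<Longrightarrow> q \<in> monomial_ideal n M \<Longrightarrow> p + q \<in> monomial_ideal n M"
  using keys_add[of p q] by (auto simp: monomial_ideal_def)

lemma mult_in_monomial_ideal:
  assumes "p \<in> monomial_ideal n M" "q \<in> monomial_ideal n N"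
    and "\<And>u v. u \<in> monomials n \<inter> M \<Longrightarrow> v \<in> monomials n \<inter> N \<Longrightarrow> u + v \<in> L"
  shows "p * q \<in> monomial_ideal n L"
proof -
  have "k \<in> monomials n \<inter> L" if k: "k \<in> Poly_Mapping.keys (p * q)" for k
  proof -
    obtain u v where "k = u + v" "u \<in> Poly_Mapping.keys p" "v \<in> Poly_Mapping.keys q"
      using keys_mult[of p q] k by auto
    moreover from this have "u \<in> monomials n \<inter> M" "v \<in> monomials n \<inter> N"
      using assms(1,2) by (auto simp: monomial_ideal_def)
    ultimately show ?thesis using assms(3) by (auto intro: monomials_add)
  qed
  then show ?thesis by (auto simp: monomial_ideal_def)
qed

lemma ideal_monomial_ideal:
  assumes "absorbing n M"
  shows "ideal (monomial_ideal n M) (poly_ring n :: 'k::field mpoly ring)"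
proof (rule idealI)
  interpret R: cring "poly_ring n :: 'k mpoly ring" by (rule cring_poly_ring)
  show "subgroup (monomial_ideal n M) (add_monoid (poly_ring n :: 'k mpoly ring))"
  proof (rule R.add.subgroupI)
    show "monomial_ideal n M \<subseteq> carrier (poly_ring n :: 'k mpoly ring)"
      by (auto simp: carrier_poly_ring monomial_ideal_def)
    have "0 \<in> (monomial_ideal n M :: 'k mpoly set)" by (simp add: monomial_ideal_def)
    then show "(monomial_ideal n M :: 'k mpoly set) \<noteq> {}" by blast
  next
    fix p :: "'k mpoly" assume p: "p \<in> monomial_ideal n M"
    have "- p \<in> carrier (poly_ring n)" "- p \<oplus>\<^bsub>poly_ring n\<^esub> p = \<zero>\<^bsub>poly_ring n\<^esub>"
      using p by (auto simp: carrier_poly_ring monomial_ideal_def)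
    moreover have "p \<in> carrier (poly_ring n)"
      using p by (auto simp: carrier_poly_ring monomial_ideal_def)
    ultimately have "\<ominus>\<^bsub>poly_ring n\<^esub> p = - p"
      using R.minus_equality by blast
    then show "\<ominus>\<^bsub>poly_ring n\<^esub> p \<in> monomial_ideal n M"
      using p by (auto simp: monomial_ideal_def)
  next
    fix p q :: "'k mpoly" assume "p \<in> monomial_ideal n M" "q \<in> monomial_ideal n M"
    then show "p \<oplus>\<^bsub>poly_ring n\<^esub> q \<in> monomial_ideal n M"
      by (simp add: add_in_monomial_ideal)
  qed
next
  fix p x :: "'k mpoly"
  assume p: "p \<in> monomial_ideal n M" and x: "x \<in> carrier (poly_ring n)"
  have "x * p \<in> monomial_ideal n M"
    using x p unfolding carrier_poly_ring
    by (rule mult_in_monomial_ideal) (use assms in \<open>auto simp: absorbing_def\<close>)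
  then show "x \<otimes>\<^bsub>poly_ring n\<^esub> p \<in> monomial_ideal n M"
    "p \<otimes>\<^bsub>poly_ring n\<^esub> x \<in> monomial_ideal n M"
    by (simp_all add: mult.commute)
qed (rule ring_poly_ring)

text \<open>
  A polynomial is the sum of its terms, and each term is a constant multiple of a monomial. So an
  inclusion of a monomial ideal in another ideal can be checked on monomials.
\<close>

lemma monomial_ideal_subset:
  fixes J :: "'k::field mpoly set"
  assumes J: "ideal J (poly_ring n)"
    and single: "\<And>m. m \<in> monomials n \<Longrightarrow> m \<in> M \<Longrightarrow> Poly_Mapping.single m 1 \<in> J"
  shows "monomial_ideal n M \<subseteq> J"
proof
  interpret J: ideal J "poly_ring n" by (rule J)
  have add: "x + y \<in> J" if "x \<in> J" "y \<in> J" for x y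
    using additive_subgroup.a_closed[OF J.additive_subgroup_axioms that] by simp
  have zero: "0 \<in> J" using additive_subgroup.zero_closed[OF J.additive_subgroup_axioms] by simp
  have sum_closed: "sum f A \<in> J" if "\<And>x. x \<in> A \<Longrightarrow> f x \<in> J" for f and A :: "monomial set"
    using that by (induction A rule: infinite_finite_induct) (auto intro: add zero)
  fix p :: "'k mpoly" assume p: "p \<in> monomial_ideal n M"
  have single_term: "Poly_Mapping.single m (Poly_Mapping.lookup p m) \<in> J"
    if "m \<in> Poly_Mapping.keys p" for m
  proof -
    have m: "m \<in> monomials n" "m \<in> M" using p that by (auto simp: monomial_ideal_def)
    have "Poly_Mapping.single 0 (Poly_Mapping.lookup p m) \<in> carrier (poly_ring n)"
      by (simp add: poly_ring_def monomials_def)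
    from J.I_l_closed[OF single[OF m] this] show ?thesis
      by (simp add: mult_single)
  qed
  have "(\<Sum>m\<in>Poly_Mapping.keys p. Poly_Mapping.single m (Poly_Mapping.lookup p m)) \<in> J"
    by (rule sum_closed) (rule single_term)
  moreover have "(\<Sum>m\<in>Poly_Mapping.keys p. Poly_Mapping.single m (Poly_Mapping.lookup p m)) = p"
  proof (rule poly_mapping_eqI)
    fix k
    show "Poly_Mapping.lookup
        (\<Sum>m\<in>Poly_Mapping.keys p. Poly_Mapping.single m (Poly_Mapping.lookup p m)) k
      = Poly_Mapping.lookup p k"
      by (cases "k \<in> Poly_Mapping.keys p")
        (auto simp: lookup_sum lookup_single when_def in_keys_iff)
  qed
  ultimately show "p \<in> J" by simp
qed

lemma Idl_monomials:
  assumes M: "absorbing n M" and G: "G \<subseteq> monomials n \<inter> M"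
    and gen: "\<And>m. m \<in> monomials n \<Longrightarrow> m \<in> M \<Longrightarrow> \<exists>g\<in>G. \<exists>u\<in>monomials n. m = u + g"
  shows "Idl\<^bsub>poly_ring n\<^esub> ((\<lambda>m. Poly_Mapping.single m 1) ` G) =
    (monomial_ideal n M :: 'k::field mpoly set)" (is "Idl\<^bsub>_\<^esub> ?S = _")
proof
  interpret R: cring "poly_ring n :: 'k mpoly ring" by (rule cring_poly_ring)
  have S: "?S \<subseteq> monomial_ideal n M"
    using G by (auto intro!: single_in_monomial_ideal)
  then show "Idl\<^bsub>poly_ring n\<^esub> ?S \<subseteq> (monomial_ideal n M :: 'k mpoly set)"
    by (rule R.genideal_minimal[OF ideal_monomial_ideal[OF M]])
  have Sc: "?S \<subseteq> carrier (poly_ring n :: 'k mpoly ring)"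
    using S by (auto simp: carrier_poly_ring monomial_ideal_def)
  interpret J: ideal "Idl\<^bsub>poly_ring n\<^esub> ?S" "poly_ring n :: 'k mpoly ring"
    by (rule R.genideal_ideal[OF Sc])
  show "(monomial_ideal n M :: 'k mpoly set) \<subseteq> Idl\<^bsub>poly_ring n\<^esub> ?S"
  proof (rule monomial_ideal_subset[OF J.is_ideal])
    fix m assume "m \<in> monomials n" "m \<in> M"
    then obtain g u where g: "g \<in> G" and u: "u \<in> monomials n" and m: "m = u + g"
      using gen by blast
    have "Poly_Mapping.single g 1 \<in> Idl\<^bsub>poly_ring n\<^esub> ?S"
      using R.genideal_self[OF Sc] g by blast
    moreover have "Poly_Mapping.single u (1::'k) \<in> carrier (poly_ring n)"
      using u by (simp add: poly_ring_def)
    ultimately have "Poly_Mapping.single u 1 \<otimes>\<^bsub>poly_ring n\<^esub> Poly_Mapping.single g (1::'k)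
        \<in> Idl\<^bsub>poly_ring n\<^esub> ?S"
      by (rule J.I_l_closed)
    then show "Poly_Mapping.single m 1 \<in> Idl\<^bsub>poly_ring n\<^esub> ?S"
      by (simp add: m mult_single)
  qed
qed

text \<open>
  Discarding from \<open>p\<close> and \<open>q\<close> the terms with monomials in \<open>M\<close> does not change whether they, or
  their product, lie in the ideal. After that, \<open>p q\<close> has no monomial in \<open>M\<close> at all, because the
  complement of \<open>M\<close> is closed under multiplication; if \<open>p q\<close> lies in the ideal, it must vanish, and
  polynomials have no zero divisors.
\<close>

lemma primeideal_monomial_ideal:
  assumes M: "absorbing n M" and zero: "0 \<notin> M"
    and comp: "\<And>u v. u \<notin> M \<Longrightarrow> v \<notin> M \<Longrightarrow> u + v \<notin> M"
  shows "primeideal (monomial_ideal n M) (poly_ring n :: 'k::field mpoly ring)"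
proof (rule primeidealI[OF ideal_monomial_ideal[OF M] cring_poly_ring])
  have "(1::'k mpoly) \<in> carrier (poly_ring n)" "(1::'k mpoly) \<notin> monomial_ideal n M"
    using zero by (auto simp: poly_ring_def monomial_ideal_def monomials_def)
  then show "carrier (poly_ring n :: 'k mpoly ring) \<noteq> monomial_ideal n M" by blast
  fix p q :: "'k mpoly"
  assume p: "p \<in> carrier (poly_ring n)" and q: "q \<in> carrier (poly_ring n)"
    and "p \<otimes>\<^bsub>poly_ring n\<^esub> q \<in> monomial_ideal n M"
  then have pq: "p * q \<in> monomial_ideal n M" by simp
  \<comment> \<open>The part of a polynomial that is left after discarding the terms in the ideal.\<close>
  define low :: "'k mpoly \<Rightarrow> 'k mpoly" where
    "low f = Poly_Mapping.mapp (\<lambda>m c. c when m \<notin> M) f" for f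
  have low: "Poly_Mapping.lookup (low f) m = (Poly_Mapping.lookup f m when m \<notin> M)" for f m
    by (auto simp: low_def lookup_mapp when_def in_keys_iff)
  have low_keys: "Poly_Mapping.keys (low f) \<subseteq> Poly_Mapping.keys f - M" for f
    by (auto simp: in_keys_iff low)
  have low_carrier: "low f \<in> carrier (poly_ring n)" if "f \<in> carrier (poly_ring n)" for f
    using that low_keys[of f] by (auto simp: poly_ring_def)
  have high: "f - low f \<in> monomial_ideal n M" if "f \<in> carrier (poly_ring n)" for f
  proof -
    have "m \<in> Poly_Mapping.keys f \<and> m \<in> M" if "m \<in> Poly_Mapping.keys (f - low f)" for m
      using that by (auto simp: in_keys_iff lookup_minus low when_def split: if_splits)
    then show ?thesis using that by (auto simp: poly_ring_def monomial_ideal_def)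
  qed
  interpret I: ideal "monomial_ideal n M" "poly_ring n :: 'k mpoly ring"
    by (rule ideal_monomial_ideal[OF M])
  have "(p - low p) * q \<in> monomial_ideal n M"
    using I.I_r_closed[OF high[OF p] q] by simp
  moreover have "low p * (q - low q) \<in> monomial_ideal n M"
    using I.I_l_closed[OF high[OF q] low_carrier[OF p]] by simp
  ultimately have sum: "(p - low p) * q + low p * (q - low q) \<in> monomial_ideal n M"
    by (rule add_in_monomial_ideal)
  have prod: "low p * low q = p * q - ((p - low p) * q + low p * (q - low q))"
    by (simp add: algebra_simps)
  have "low p * low q = 0"
  proof (rule poly_mapping_eqI)
    fix k
    show "Poly_Mapping.lookup (low p * low q) k = Poly_Mapping.lookup 0 k"
    proof (cases "k \<in> Poly_Mapping.keys (low p * low q)")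
      case True
      then obtain u v where "k = u + v" "u \<in> Poly_Mapping.keys (low p)" "v \<in> Poly_Mapping.keys (low q)"
        using keys_mult[of "low p" "low q"] by auto
      then have "k \<notin> M" using comp low_keys by blast
      then have "k \<notin> Poly_Mapping.keys (p * q)"
        "k \<notin> Poly_Mapping.keys ((p - low p) * q + low p * (q - low q))"
        using pq sum by (auto simp: monomial_ideal_def)
      then show ?thesis unfolding prod lookup_minus in_keys_iff by simp
    qed (simp add: in_keys_iff)
  qed
  then have "low p = 0 \<or> low q = 0" by simp
  then show "p \<in> monomial_ideal n M \<or> q \<in> monomial_ideal n M"
    using high[OF p] high[OF q] by auto
qed

text \<open>
  Every homogeneous generator has a monomial of its own degree, and this monomial lies in \<open>M\<close>;
  conversely every monomial of \<open>M\<close> belongs to the generating system of all monomials in \<open>M\<close>. So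
  the two sets of degrees that are minimised coincide.
\<close>

lemma alpha_monomial_ideal:
  assumes M: "absorbing n M"
  shows "alpha n (monomial_ideal n M :: 'k::field mpoly set) =
    (LEAST d. \<exists>m\<in>monomials n \<inter> M. monomial_degree m = d)"
  unfolding alpha_def
proof (rule arg_cong[where f = Least], rule ext, rule iffI)
  interpret R: cring "poly_ring n :: 'k mpoly ring" by (rule cring_poly_ring)
  fix d
  show "\<exists>m\<in>monomials n \<inter> M. monomial_degree m = d"
    if "\<exists>G\<subseteq>carrier (poly_ring n). (\<forall>g\<in>G. \<exists>e. homogeneous_of_degree e g) \<and>
      monomial_ideal n M = Idl\<^bsub>poly_ring n\<^esub> G \<and> (\<exists>g::'k mpoly\<in>G. homogeneous_of_degree d g)"
  proof -
    from that obtain G and g :: "'k mpoly" where G: "G \<subseteq> carrier (poly_ring n)"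
      and I: "monomial_ideal n M = Idl\<^bsub>poly_ring n\<^esub> G" and g: "g \<in> G" "homogeneous_of_degree d g"
      by auto
    have "g \<in> monomial_ideal n M" using R.genideal_self[OF G] g I by auto
    moreover from g obtain m where "m \<in> Poly_Mapping.keys g" "monomial_degree m = d"
      unfolding homogeneous_of_degree_def by (meson all_not_in_conv keys_eq_empty)
    ultimately show ?thesis by (auto simp: monomial_ideal_def)
  qed
  assume "\<exists>m\<in>monomials n \<inter> M. monomial_degree m = d"
  then obtain m where m: "m \<in> monomials n \<inter> M" "monomial_degree m = d" by auto
  have hom: "homogeneous_of_degree (monomial_degree u) (Poly_Mapping.single u (1::'k))" for u
    by (simp add: homogeneous_of_degree_def)
      (metis lookup_single_eq lookup_zero zero_neq_one)
  let ?G = "(\<lambda>m. Poly_Mapping.single m (1::'k)) ` (monomials n \<inter> M)"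
  have "Idl\<^bsub>poly_ring n\<^esub> ?G = monomial_ideal n M"
  proof (rule Idl_monomials[OF M order_refl])
    fix u assume "u \<in> monomials n" "u \<in> M"
    then show "\<exists>g\<in>monomials n \<inter> M. \<exists>v\<in>monomials n. u = v + g"
      by (intro bexI[of _ u] bexI[of _ 0]) (auto simp: monomials_def)
  qed
  then show "\<exists>G\<subseteq>carrier (poly_ring n). (\<forall>g\<in>G. \<exists>e. homogeneous_of_degree e g) \<and>
      monomial_ideal n M = Idl\<^bsub>poly_ring n\<^esub> G \<and> (\<exists>g::'k mpoly\<in>G. homogeneous_of_degree d g)"
    using hom m by (intro exI[of _ ?G]) (fastforce simp: poly_ring_def)
qed

section \<open>Powers of the monomial primes\<close>

definition partial_degree :: "nat set \<Rightarrow> monomial \<Rightarrow> nat" where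
  "partial_degree C m = (\<Sum>i\<in>C. Poly_Mapping.lookup m i)"

text \<open>
  The \<open>q\<close>-th power of the prime ideal \<open>(x\<^sub>i : i \<in> C)\<close>, described through its monomials. That it is
  a power in the monoid of ideals when \<open>C \<subseteq> {1..n}\<close> is the content of \<open>variable_ideal_pow\<close>.
\<close>

definition variable_ideal_power :: "nat \<Rightarrow> nat set \<Rightarrow> nat \<Rightarrow> 'k::field mpoly set" where
  "variable_ideal_power n C q = monomial_ideal n {m. q \<le> partial_degree C m}"

lemma partial_degree_add: "partial_degree C (u + v) = partial_degree C u + partial_degree C v"
  by (simp add: partial_degree_def lookup_add sum.distrib)

lemma partial_degree_zero [simp]: "partial_degree C 0 = 0"
  by (simp add: partial_degree_def)

lemma partial_degree_single:
  "finite C \<Longrightarrow> partial_degree C (Poly_Mapping.single i k) = (if i \<in> C then k else 0)"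
  by (simp add: partial_degree_def lookup_single when_def)

lemma monomial_degree_eq: "m \<in> monomials n \<Longrightarrow> monomial_degree m = partial_degree {1..n} m"
  unfolding monomial_degree_def partial_degree_def monomials_def
  by (rule sum.mono_neutral_left) (auto simp: in_keys_iff)

lemma absorbing_partial_degree: "absorbing n {m. q \<le> partial_degree C m}"
  by (auto simp: absorbing_def partial_degree_add)

text \<open>
  Subtraction of exponent vectors truncates at zero, so the difference is always a monomial; it is
  the exact quotient only under the divisibility hypothesis of \<open>diff_add_monomial\<close>.
\<close>

lemma monomials_diff: "m \<in> monomials n \<Longrightarrow> m - u \<in> monomials n"
  by (auto simp: monomials_def in_keys_iff lookup_minus)

lemma diff_add_monomial:
  fixes m u :: monomial
  assumes "\<And>i. Poly_Mapping.lookup u i \<le> Poly_Mapping.lookup m i"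
  shows "(m - u) + u = m"
  by (rule poly_mapping_eqI) (simp add: lookup_add lookup_minus assms)

text \<open>
  The inclusion from right to left splits one variable with index in \<open>C\<close> off a monomial of positive
  degree in these variables.
\<close>

lemma variable_ideal_prod:
  assumes C: "C \<subseteq> {1..n}"
  shows "ideal_prod (poly_ring n) (variable_ideal_power n C q) (variable_ideal_power n C 1) =
    (variable_ideal_power n C (Suc q) :: 'k::field mpoly set)" (is "?L = ?R")
proof
  interpret R: cring "poly_ring n :: 'k mpoly ring" by (rule cring_poly_ring)
  show "?L \<subseteq> ?R"
  proof
    fix s :: "'k mpoly" assume "s \<in> ?L"
    then show "s \<in> ?R"
    proof induction
      case (prod i j)
      then have "i * j \<in> ?R"
        unfolding variable_ideal_power_def
        by (rule mult_in_monomial_ideal) (auto simp: partial_degree_add)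
      then show ?case by simp
    next
      case (sum s t)
      then show ?case
        unfolding variable_ideal_power_def by (simp add: add_in_monomial_ideal)
    qed
  qed
  have L: "ideal ?L (poly_ring n)"
    unfolding variable_ideal_power_def
    by (intro R.ideal_prod_is_ideal ideal_monomial_ideal absorbing_partial_degree)
  show "?R \<subseteq> ?L"
    unfolding variable_ideal_power_def[of n C "Suc q"]
  proof (rule monomial_ideal_subset[OF L])
    fix m assume m: "m \<in> monomials n" "m \<in> {m. Suc q \<le> partial_degree C m}"
    then obtain i where i: "i \<in> C" "Poly_Mapping.lookup m i \<noteq> 0"
      unfolding partial_degree_def by (metis mem_Collect_eq not_less_eq_eq sum.neutral zero_le)
    have fin: "finite C" using C finite_subset by blast
    define u where "u = m - Poly_Mapping.single i 1"
    have mu: "u + Poly_Mapping.single i 1 = m"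
      unfolding u_def by (rule diff_add_monomial) (use i in \<open>auto simp: lookup_single when_def\<close>)
    have "partial_degree C m = partial_degree C u + 1"
      using i fin unfolding mu[symmetric] partial_degree_add by (simp add: partial_degree_single)
    then have "Poly_Mapping.single u (1::'k) \<in> variable_ideal_power n C q"
      unfolding variable_ideal_power_def
      using m by (intro single_in_monomial_ideal) (auto simp: u_def monomials_diff)
    moreover have "Poly_Mapping.single (Poly_Mapping.single i 1) (1::'k) \<in> variable_ideal_power n C 1"
      unfolding variable_ideal_power_def
      using i C fin by (intro single_in_monomial_ideal) (auto simp: monomials_def partial_degree_single)
    ultimately have "Poly_Mapping.single u (1::'k) \<otimes>\<^bsub>poly_ring n\<^esub>
        Poly_Mapping.single (Poly_Mapping.single i 1) 1 \<in> ?L"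
      by (rule ideal_prod.prod)
    then show "Poly_Mapping.single m 1 \<in> ?L"
      using mu by (simp add: mult_single)
  qed
qed

lemma variable_ideal_pow:
  assumes "C \<subseteq> {1..n}"
  shows "variable_ideal_power n C 1 [^]\<^bsub>ideals_set (poly_ring n)\<^esub> q =
    (variable_ideal_power n C q :: 'k::field mpoly set)"
proof (induction q)
  case 0
  show ?case
    by (simp add: nat_pow_def ideals_set_def carrier_poly_ring variable_ideal_power_def)
next
  case (Suc q)
  have "variable_ideal_power n C 1 [^]\<^bsub>ideals_set (poly_ring n)\<^esub> Suc q =
    ideal_prod (poly_ring n) (variable_ideal_power n C 1 [^]\<^bsub>ideals_set (poly_ring n)\<^esub> q)
      (variable_ideal_power n C 1 :: 'k mpoly set)"
    by (simp add: nat_pow_def ideals_set_def)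
  then show ?case by (simp only: Suc variable_ideal_prod[OF assms])
qed

lemma primeideal_variable_ideal:
  "primeideal (variable_ideal_power n C 1) (poly_ring n :: 'k::field mpoly ring)"
  unfolding variable_ideal_power_def
  by (rule primeideal_monomial_ideal[OF absorbing_partial_degree]) (auto simp: partial_degree_add)

lemma variable_ideal_subset_iff:
  assumes "C \<subseteq> {1..n}" "C' \<subseteq> {1..n}"
  shows "(variable_ideal_power n C 1 :: 'k::field mpoly set) \<subseteq> variable_ideal_power n C' 1
    \<longleftrightarrow> C \<subseteq> C'" (is "?P \<subseteq> ?P' \<longleftrightarrow> _")
proof
  assume sub: "?P \<subseteq> ?P'"
  have fin: "finite C" "finite C'" using assms finite_subset by blast+
  show "C \<subseteq> C'"
  proof
    fix i assume i: "i \<in> C"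
    then have "Poly_Mapping.single (Poly_Mapping.single i 1) 1 \<in> ?P"
      unfolding variable_ideal_power_def
      using assms fin by (intro single_in_monomial_ideal) (auto simp: monomials_def partial_degree_single)
    with sub have "Poly_Mapping.single (Poly_Mapping.single i 1) 1 \<in> ?P'" by blast
    then show "i \<in> C'"
      using fin by (auto simp: variable_ideal_power_def monomial_ideal_def partial_degree_single split: if_splits)
  qed
next
  assume "C \<subseteq> C'"
  moreover have "finite C'" using assms finite_subset by blast
  ultimately have "partial_degree C m \<le> partial_degree C' m" for m
    unfolding partial_degree_def by (intro sum_mono2) auto
  then show "?P \<subseteq> ?P'"
    unfolding variable_ideal_power_def monomial_ideal_def by (auto intro: order_trans)
qed

section \<open>The square-free Veronese ideal\<close>

text \<open>
  Square-free monomials correspond to finite sets of variables, so that Borel moves on them become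
  exchanges of set elements.
\<close>

definition subset_monomial :: "nat set \<Rightarrow> monomial" where
  "subset_monomial S = (\<Sum>i\<in>S. Poly_Mapping.single i 1)"

lemma lookup_subset_monomial:
  "finite S \<Longrightarrow> Poly_Mapping.lookup (subset_monomial S) i = (if i \<in> S then 1 else 0)"
  by (simp add: subset_monomial_def lookup_sum lookup_single when_def)

lemma keys_subset_monomial: "finite S \<Longrightarrow> Poly_Mapping.keys (subset_monomial S) = S"
  by (auto simp: in_keys_iff lookup_subset_monomial split: if_splits)

lemma squarefree_subset_monomial: "finite S \<Longrightarrow> squarefree_monomial (subset_monomial S)"
  by (simp add: squarefree_monomial_def lookup_subset_monomial)

lemma monomial_degree_subset_monomial: "finite S \<Longrightarrow> monomial_degree (subset_monomial S) = card S"
  by (simp add: monomial_degree_def keys_subset_monomial lookup_subset_monomial)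

lemma squarefree_degree: "squarefree_monomial m \<Longrightarrow> monomial_degree m = card (Poly_Mapping.keys m)"
  unfolding squarefree_monomial_def monomial_degree_def card_eq_sum
  by (rule sum.cong) (auto simp: in_keys_iff intro: le_antisym)

lemma borel_move_invariant:
  assumes "borel_move m m'" "m \<in> monomials n"
  shows "m' \<in> monomials n \<and> monomial_degree m' = monomial_degree m"
proof -
  obtain i j where i: "i \<in> Poly_Mapping.keys m" and j: "j \<in> {1..<i}"
    and m': "m' = Poly_Mapping.single j 1 + (m - Poly_Mapping.single i 1)"
    using assms by (auto simp: borel_move_def)
  define u where "u = m - Poly_Mapping.single i 1"
  have u: "u \<in> monomials n" unfolding u_def by (rule monomials_diff[OF assms(2)])
  have m: "m = u + Poly_Mapping.single i 1"
    unfolding u_def by (rule diff_add_monomial[symmetric])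
      (use i in \<open>auto simp: lookup_single when_def in_keys_iff\<close>)
  have i': "i \<in> {1..n}" using i assms(2) by (auto simp: monomials_def)
  then have j': "j \<in> {1..n}" using j by auto
  then have mn: "m' \<in> monomials n"
    unfolding m' u_def[symmetric] by (intro monomials_add u) (auto simp: monomials_def)
  show ?thesis
    using mn assms(2) i' j'
    by (simp add: monomial_degree_eq m' flip: u_def)
      (simp add: m partial_degree_add partial_degree_single)
qed

lemma borel_moves_invariant:
  assumes "borel_move\<^sup>*\<^sup>* m m'" "m \<in> monomials n"
  shows "m' \<in> monomials n \<and> monomial_degree m' = monomial_degree m"
  using assms by induction (auto dest: borel_move_invariant)

text \<open>
  Induction on the number of elements of \<open>S\<close> outside the top block \<open>{b..n}\<close>. Exchanging such an
  element \<open>j\<close> for a missing element \<open>i\<close> of the block brings \<open>S\<close> closer to the block, and since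
  \<open>j < i\<close>, undoing the exchange is a Borel move.
\<close>

lemma borel_moves_from_top:
  assumes "S \<subseteq> {1..n}" "card S = card {b..n}"
  shows "borel_move\<^sup>*\<^sup>* (subset_monomial {b..n}) (subset_monomial S)"
  using assms
proof (induction "card (S - {b..n})" arbitrary: S)
  case 0
  have "finite S" using 0(2) finite_subset by blast
  with 0 have "S \<subseteq> {b..n}" by auto
  with 0 have "S = {b..n}" by (intro card_subset_eq) auto
  then show ?case by simp
next
  case (Suc k)
  have fin: "finite S" using Suc.prems(1) finite_subset by blast
  from Suc.hyps(2) obtain j where j: "j \<in> S" "j \<notin> {b..n}"
    by (metis Diff_iff all_not_in_conv card.empty nat.simps(3))
  have "\<not> {b..n} \<subseteq> S"
  proof
    assume "{b..n} \<subseteq> S"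
    then have "{b..n} = S" using fin Suc.prems(2) by (intro card_subset_eq) auto
    with j show False by auto
  qed
  then obtain i where i: "i \<in> {b..n}" "i \<notin> S" by blast
  have ji: "1 \<le> j" "j < i" using j i Suc.prems(1) by auto
  define S' where "S' = insert i (S - {j})"
  have fin': "finite S'" using fin by (simp add: S'_def)
  have "S' - {b..n} = (S - {b..n}) - {j}" using i j by (auto simp: S'_def)
  then have 1: "k = card (S' - {b..n})"
    using Suc.hyps(2) j fin by simp
  have 2: "S' \<subseteq> {1..n}" using Suc.prems(1) i ji by (auto simp: S'_def)
  have 3: "card S' = card {b..n}"
    using Suc.prems(2) j i fin card_Suc_Diff1[of S j] by (simp add: S'_def)
  have "borel_move (subset_monomial S') (subset_monomial S)"
    unfolding borel_move_def
  proof (intro bexI)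
    show "subset_monomial S = Poly_Mapping.single j 1 + (subset_monomial S' - Poly_Mapping.single i 1)"
      by (rule poly_mapping_eqI)
        (use fin fin' j i ji in \<open>auto simp: lookup_subset_monomial lookup_add lookup_minus
          lookup_single when_def S'_def\<close>)
    show "j \<in> {1..<i}" using ji by simp
    show "i \<in> Poly_Mapping.keys (subset_monomial S')"
      using fin' by (simp add: keys_subset_monomial S'_def)
  qed
  with Suc.hyps(1)[OF 1 2 3] show ?case by (rule rtranclp.rtrancl_into_rtrancl)
qed

text \<open>
  The exponent vectors of the \<open>q\<close>-th symbolic power: a monomial has order at least \<open>q\<close> along each
  of the coordinate subspaces on which some \<open>b\<close> of the \<open>n\<close> variables vanish.
\<close>

definition subset_orders :: "nat \<Rightarrow> nat \<Rightarrow> nat \<Rightarrow> monomial set" where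
  "subset_orders n b q = {m. \<forall>C. C \<subseteq> {1..n} \<and> card C = b \<longrightarrow> q \<le> partial_degree C m}"

lemma absorbing_subset_orders: "absorbing n (subset_orders n b q)"
  by (auto simp: absorbing_def partial_degree_add subset_orders_def trans_le_add2)

lemma partial_degree_pos_iff:
  "finite C \<Longrightarrow> 0 < partial_degree C m \<longleftrightarrow> C \<inter> Poly_Mapping.keys m \<noteq> {}"
  unfolding neq0_conv[symmetric] partial_degree_def by (auto simp: in_keys_iff)

text \<open>
  Both directions are the pigeonhole principle: sets of sizes \<open>b\<close> and \<open>n - b + 1\<close> in \<open>{1..n}\<close> must
  meet, and a set with fewer than \<open>n - b + 1\<close> elements has a complement with at least \<open>b\<close>
  elements.
\<close>

lemma sfBorel_veronese:
  assumes "1 \<le> b" "b \<le> n"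
  shows "sfBorel n (subset_monomial {b..n}) =
    (monomial_ideal n (subset_orders n b 1) :: 'k::field mpoly set)"
proof -
  let ?top = "subset_monomial {b..n}"
  let ?G = "{m'. borel_move\<^sup>*\<^sup>* ?top m' \<and> squarefree_monomial m'}"
  have top: "?top \<in> monomials n"
    using assms by (simp add: monomials_def keys_subset_monomial)
  have "Idl\<^bsub>poly_ring n\<^esub> ((\<lambda>m. Poly_Mapping.single m 1) ` ?G) =
    (monomial_ideal n (subset_orders n b 1) :: 'k mpoly set)"
  proof (rule Idl_monomials[OF absorbing_subset_orders])
    show "?G \<subseteq> monomials n \<inter> subset_orders n b 1"
    proof
      fix m assume m: "m \<in> ?G"
      with top have mn: "m \<in> monomials n" and "monomial_degree m = monomial_degree ?top"
        using borel_moves_invariant[of ?top m n] by auto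
      with m have card: "card (Poly_Mapping.keys m) = n - b + 1"
        using assms by (simp add: squarefree_degree monomial_degree_subset_monomial)
      have "1 \<le> partial_degree C m" if C: "C \<subseteq> {1..n}" "card C = b" for C
      proof -
        have fin: "finite C" using C finite_subset by blast
        have "C \<inter> Poly_Mapping.keys m \<noteq> {}"
        proof
          assume "C \<inter> Poly_Mapping.keys m = {}"
          then have "card (C \<union> Poly_Mapping.keys m) = b + (n - b + 1)"
            using fin C card by (simp add: card_Un_disjoint)
          moreover have "card (C \<union> Poly_Mapping.keys m) \<le> card {1..n}"
            using C mn by (intro card_mono) (auto simp: monomials_def)
          ultimately show False using assms by simp
        qed
        then show ?thesis using fin by (simp add: partial_degree_pos_iff Suc_le_eq)
      qed
      with mn show "m \<in> monomials n \<inter> subset_orders n b 1" by (simp add: subset_orders_def)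
    qed
  next
    fix m assume m: "m \<in> monomials n" "m \<in> subset_orders n b 1"
    let ?K = "Poly_Mapping.keys m"
    have K: "?K \<subseteq> {1..n}" using m by (simp add: monomials_def)
    have "card ?K \<ge> n - b + 1"
    proof (rule ccontr)
      assume "\<not> ?thesis"
      then have "b \<le> card ({1..n} - ?K)" using K assms by (simp add: card_Diff_subset)
      then obtain C where C: "C \<subseteq> {1..n} - ?K" "card C = b" "finite C"
        by (rule obtain_subset_with_card_n)
      then have "1 \<le> partial_degree C m" using m by (auto simp: subset_orders_def)
      with C show False by (auto simp: partial_degree_pos_iff Suc_le_eq)
    qed
    then obtain S where S: "S \<subseteq> ?K" "card S = n - b + 1" "finite S"
      by (rule obtain_subset_with_card_n)
    have "borel_move\<^sup>*\<^sup>* ?top (subset_monomial S)"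
      using S K assms by (intro borel_moves_from_top) auto
    then have "subset_monomial S \<in> ?G" using S by (simp add: squarefree_subset_monomial)
    moreover have "m = (m - subset_monomial S) + subset_monomial S"
      by (rule diff_add_monomial[symmetric])
        (use S in \<open>auto simp: lookup_subset_monomial in_keys_iff Suc_le_eq\<close>)
    ultimately show "\<exists>g\<in>?G. \<exists>u\<in>monomials n. m = u + g"
      using monomials_diff[OF m(1)] by blast
  qed
  then show ?thesis unfolding sfBorel_def by (simp add: setcompr_eq_image)
qed

text \<open>
  Prime ideals generated by sets of variables are ordered like the sets, and distinct sets with the
  same number of elements are incomparable. Hence the decomposition into the primes of the
  \<open>b\<close>-subsets is the minimal one.
\<close>

lemma symbolic_power_veronese:
  assumes "b \<le> n"
  shows "symbolic_power (poly_ring n) (monomial_ideal n (subset_orders n b 1)) q =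
    (monomial_ideal n (subset_orders n b q) :: 'k::field mpoly set)"
proof -
  let ?\<C> = "{C. C \<subseteq> {1..n} \<and> card C = b}"
  let ?\<P> = "(\<lambda>C. variable_ideal_power n C 1 :: 'k mpoly set) ` ?\<C>"
  have Inter: "carrier (poly_ring n) \<inter> (\<Inter>C\<in>?\<C>. variable_ideal_power n C k) =
    (monomial_ideal n (subset_orders n b k) :: 'k mpoly set)" for k
    unfolding carrier_poly_ring variable_ideal_power_def monomial_ideal_def subset_orders_def
    by blast
  have "(THE \<Q>. minimal_primary_decomposition (poly_ring n)
      (monomial_ideal n (subset_orders n b 1)) \<Q>) = ?\<P>"
  proof (rule cring.minimal_primary_decomposition_unique[OF cring_poly_ring])
    show "finite ?\<P>" by simp
    show "primeideal P (poly_ring n)" if "P \<in> ?\<P>" for P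
      using that primeideal_variable_ideal by auto
    show "monomial_ideal n (subset_orders n b 1) = carrier (poly_ring n) \<inter> \<Inter> ?\<P>"
      using Inter[of 1] by simp
    fix P P' assume "P \<in> ?\<P>" "P' \<in> ?\<P>" and sub: "P \<subseteq> P'"
    then obtain C C' where C: "C \<subseteq> {1..n}" "card C = b" "P = variable_ideal_power n C 1"
      and C': "C' \<subseteq> {1..n}" "card C' = b" "P' = variable_ideal_power n C' 1"
      by auto
    have "C \<subseteq> C'" using sub C C' by (simp add: variable_ideal_subset_iff del: One_nat_def)
    then have "C = C'" using C C' finite_subset[of C' "{1..n}"] by (intro card_subset_eq) auto
    with C C' show "P = P'" by simp
  qed
  then have "symbolic_power (poly_ring n) (monomial_ideal n (subset_orders n b 1)) q =
    carrier (poly_ring n) \<inter> (\<Inter>P\<in>?\<P>. P [^]\<^bsub>ideals_set (poly_ring n)\<^esub> q)"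
    unfolding symbolic_power_def by simp
  also have "(\<Inter>P\<in>?\<P>. P [^]\<^bsub>ideals_set (poly_ring n)\<^esub> q) =
      (\<Inter>C\<in>?\<C>. variable_ideal_power n C q)"
    by (simp add: variable_ideal_pow del: One_nat_def)
  finally show ?thesis by (simp only: Inter)
qed

section \<open>The Waldschmidt constant\<close>

text \<open>
  If all sums over \<open>b\<close>-subsets are at least \<open>q\<close>, the mean value of \<open>f\<close> on \<open>A\<close> is at least
  \<open>q / b\<close>. Instead of averaging over all \<open>b\<close>-subsets at once, the induction removes one element
  at a time and averages over the choice of this element.
\<close>

lemma sum_lower_bound_from_subsets:
  fixes f :: "'a \<Rightarrow> nat"
  assumes "finite A" "0 < b" "b \<le> card A"
    and "\<And>C. C \<subseteq> A \<Longrightarrow> card C = b \<Longrightarrow> q \<le> sum f C"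
  shows "card A * q \<le> b * sum f A"
  using assms
proof (induction "card A - b" arbitrary: A)
  case 0
  then have "card A = b" by simp
  with 0 show ?case by simp
next
  case (Suc k)
  define N where "N = card A - 1"
  have cA: "card A = Suc N" using Suc.hyps(2) by (simp add: N_def)
  have step: "N * q + b * f x \<le> b * sum f A" if x: "x \<in> A" for x
  proof -
    have c: "card (A - {x}) = N" using x Suc.prems(1) by (simp add: N_def)
    have "card (A - {x}) * q \<le> b * sum f (A - {x})"
      by (rule Suc.hyps(1)) (use Suc.hyps(2) Suc.prems c cA in auto)
    then show ?thesis
      using c sum.remove[OF Suc.prems(1) x, of f] by (simp add: algebra_simps)
  qed
  have "(\<Sum>x\<in>A. N * q + b * f x) \<le> (\<Sum>x\<in>A. b * sum f A)"
    by (rule sum_mono) (rule step)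
  then have "N * (card A * q) \<le> N * (b * sum f A)"
    by (simp add: sum.distrib cA sum_distrib_left[symmetric] algebra_simps)
  moreover have "0 < N" using Suc.hyps(2) Suc.prems(2) cA by simp
  ultimately show ?case by simp
qed

text \<open>
  The upper bound comes from \<open>(x\<^sub>1 \<dots> x\<^sub>n)\<^sup>c\<close>, where \<open>c\<close> is large enough for \<open>b c \<ge> q\<close> but exceeds
  \<open>q / b\<close> by at most one.
\<close>

lemma alpha_veronese_bounds:
  fixes n b q :: nat
  assumes b: "1 \<le> b" "b \<le> n"
  defines "\<alpha> \<equiv> alpha n (monomial_ideal n (subset_orders n b q) :: 'k::field mpoly set)"
  shows "n * q \<le> b * \<alpha>" and "b * \<alpha> \<le> n * (q + b)"
proof -
  let ?D = "\<lambda>d. \<exists>m\<in>monomials n \<inter> subset_orders n b q. monomial_degree m = d"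
  have \<alpha>: "\<alpha> = (LEAST d. ?D d)"
    unfolding \<alpha>_def by (rule alpha_monomial_ideal[OF absorbing_subset_orders])
  define c where "c = q div b + 1"
  have qc: "q \<le> b * c" "b * c \<le> q + b"
    using b(1) mod_less_divisor[of b q] mult_div_mod_eq[of b q]
    unfolding c_def distrib_left by linarith+
  define m where "m = (\<Sum>i\<in>{1..n}. Poly_Mapping.single i c)"
  have lookup_m: "Poly_Mapping.lookup m i = (if i \<in> {1..n} then c else 0)" for i
    by (simp add: m_def lookup_sum lookup_single when_def)
  have m: "m \<in> monomials n"
    by (auto simp: monomials_def in_keys_iff lookup_m split: if_splits)
  have pd: "partial_degree C m = card C * c" if "C \<subseteq> {1..n}" for C
  proof -
    have "partial_degree C m = (\<Sum>i\<in>C. c)"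
      unfolding partial_degree_def by (rule sum.cong) (use that in \<open>auto simp: lookup_m\<close>)
    then show ?thesis by simp
  qed
  have "m \<in> subset_orders n b q" using pd qc by (auto simp: subset_orders_def)
  moreover have "monomial_degree m = n * c" using m pd[of "{1..n}"] by (simp add: monomial_degree_eq)
  ultimately have D: "?D (n * c)" using m by auto
  then have "\<alpha> \<le> n * c" unfolding \<alpha> by (rule Least_le)
  then have "b * \<alpha> \<le> n * (b * c)" by (metis mult.left_commute mult_le_mono2)
  also have "\<dots> \<le> n * (q + b)" using qc by simp
  finally show "b * \<alpha> \<le> n * (q + b)" .
  have "?D \<alpha>" unfolding \<alpha> using D by (rule LeastI)
  then obtain u where u: "u \<in> monomials n" "u \<in> subset_orders n b q" "monomial_degree u = \<alpha>"
    by auto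
  have "card {1..n} * q \<le> b * (\<Sum>i\<in>{1..n}. Poly_Mapping.lookup u i)"
    by (rule sum_lower_bound_from_subsets)
      (use b u in \<open>auto simp: subset_orders_def partial_degree_def\<close>)
  then show "n * q \<le> b * \<alpha>" using u by (simp add: monomial_degree_eq partial_degree_def)
qed

lemma waldschmidt_veronese:
  assumes b: "1 \<le> b" "b \<le> n"
  shows "has_waldschmidt_constant n
    (monomial_ideal n (subset_orders n b 1) :: 'k::field mpoly set) (real n / real b)"
  unfolding has_waldschmidt_constant_def symbolic_power_veronese[OF b(2)]
proof (rule tendsto_sandwich)
  let ?\<alpha> = "\<lambda>q. alpha n (monomial_ideal n (subset_orders n b q) :: 'k mpoly set)"
  show "\<forall>\<^sub>F q in sequentially. real n / real b \<le> real (?\<alpha> q) / real q"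
    using eventually_gt_at_top[of 0]
  proof eventually_elim
    case (elim q)
    have "real n * real q \<le> real b * real (?\<alpha> q)"
      using alpha_veronese_bounds(1)[OF b, of q, where 'k = 'k]
      by (metis of_nat_le_iff of_nat_mult)
    then show ?case using b elim by (simp add: field_simps)
  qed
  show "\<forall>\<^sub>F q in sequentially. real (?\<alpha> q) / real q \<le> real n / real b + real n / real q"
    using eventually_gt_at_top[of 0]
  proof eventually_elim
    case (elim q)
    have "real b * real (?\<alpha> q) \<le> real n * (real q + real b)"
      using alpha_veronese_bounds(2)[OF b, of q, where 'k = 'k]
      by (metis of_nat_le_iff of_nat_mult of_nat_add)
    then show ?case using b elim by (simp add: field_simps)
  qed
  have "(\<lambda>q. real n / real b + real n / real q) \<longlonglongrightarrow> real n / real b + 0"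
    by (intro tendsto_add tendsto_const lim_const_over_n)
  then show "(\<lambda>q. real n / real b + real n / real q) \<longlonglongrightarrow> real n / real b" by simp
qed simp

theorem theorem1p1:
  fixes r :: rat
  assumes "r \<ge> 1"
  shows "\<exists>n (I :: 'k::field_char_0 mpoly set).
           sf_principal_borel_ideal n I \<and> has_waldschmidt_constant n I (of_rat r)"
proof -
  obtain p q where pq: "r = of_int p / of_int q" "q > 0"
    by (cases r) (auto simp: Fract_of_int_quotient)
  with assms have "p \<ge> q" by (simp add: field_simps)
  define n b where "n = nat p" and "b = nat q"
  have b: "1 \<le> b" "b \<le> n" using pq \<open>p \<ge> q\<close> by (auto simp: n_def b_def)
  have "(of_rat r :: real) = real n / real b"
    using pq \<open>p \<ge> q\<close> by (simp add: n_def b_def of_rat_divide)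
  moreover have "sf_principal_borel_ideal n
      (monomial_ideal n (subset_orders n b 1) :: 'k mpoly set)"
    unfolding sf_principal_borel_ideal_def
    using b sfBorel_veronese[OF b, where 'k = 'k]
    by (intro bexI[of _ "subset_monomial {b..n}"])
      (auto simp: squarefree_subset_monomial monomials_def keys_subset_monomial)
  ultimately show ?thesis using waldschmidt_veronese[OF b, where 'k = 'k] by auto
qed

end
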